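(* Let $\mathcal{C}$ be a combinatorial class whose generating series $C(x)=\sum_{k\ge1}c_kx^k$, $c_k=|\mathcal{C}_k|$, is subexponential, and let $m=\min\{k\in\mathbb{N}:c_k>0\}$. Let $\mathsf{G}_{n,N}$ be drawn uniformly at random from the set $\mathcal{G}_{n,N}$ of $\mathcal{C}$-multisets of size $n$ with $N$ components, and for a multiset $G$ let $\mathcal{L}(G)$ be the size of a largest component of $G$. Then, as $n,N,n-mN\to\infty$, $$\mathcal{L}(\mathsf{G}_{n,N})=n-mN+\mathcal{O}_p(1).$$
   Context: $\mathbb{N}=\{1,2,\dots\}$. A combinatorial class $\mathcal{C}$ is a countable set with a size function $|\cdot|:\mathcal{C}\to\mathbb{N}$ such that $\mathcal{C}_n=\{C\in\mathcal{C}:|C|=n\}$ is finite for all $n\in\mathbb{N}$. A $\mathcal{C}$-multiset is a finite set $G=\{(C_1,d_1),\dots,(C_k,d_k)\}$ with pairwise distinct $C_i\in\mathcal{C}$ and multiplicities $d_i\in\mathbb{N}$. Its size is $|G|=\sum_i d_i|C_i|$, its number of components is $\kappa(G)=\sum_i d_i$, and $\mathcal{L}(G)=\max_i|C_i|$. $\mathcal{G}_{n,N}$ is the (finite) set of $\mathcal{C}$-multisets $G$ with $|G|=n$, $\kappa(G)=N$. With $c_0=0$, the series $C(x)$ is called subexponential with radius of convergence $\rho>0$ if $c_n>0$ for all large $n$ and, as $n\to\infty$, $c_{n-1}/c_n\to\rho$ and $c_n^{-1}\sum_{1\le k\le n}c_kc_{n-k}\to2C(\rho)<\infty$ (for integer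 coefficients, as here, necessarily $\rho<1$). Limits "as $n,N,n-mN\to\infty$" are along arbitrary sequences of pairs $(n,N)\in\mathbb{N}^2$ with $n\to\infty$, $N\to\infty$, $n-mN\to\infty$. $X=a+\mathcal{O}_p(1)$ means that $X-a$ is stochastically bounded: for every $\varepsilon>0$ there is $K>0$ with $\limsup\Pr[|X-a|\ge K]\le\varepsilon$. *)

theory Defs
  imports "HOL-Probability.Probability" "HOL-Library.Multiset"
begin

text \<open>A class is a carrier set \<open>C\<close> together with a size function \<open>sz\<close>; only the values of
  \<open>sz\<close> on \<open>C\<close> matter.\<close>

definition combinatorial_class :: "'a set \<Rightarrow> ('a \<Rightarrow> nat) \<Rightarrow> bool" where
  "combinatorial_class C sz \<longleftrightarrow>
     countable C \<and> (\<forall>x\<in>C. 1 \<le> sz x) \<and> (\<forall>n. finite {x \<in> C. sz x = n})"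

definition generating_series :: "'a set \<Rightarrow> ('a \<Rightarrow> nat) \<Rightarrow> real fps" where
  "generating_series C sz = Abs_fps (\<lambda>n. real (card {x \<in> C. sz x = n}))"

text \<open>The ratio condition forces the radius of convergence to be \<open>\<rho>\<close>. Summability is the
  condition \<open>C(\<rho>) < \<infinity>\<close>; it is stated explicitly because \<open>eval_fps F \<rho>\<close> is an
  unspecified real number when the series diverges.\<close>

definition subexponential :: "real fps \<Rightarrow> real \<Rightarrow> bool" where
  "subexponential F \<rho> \<longleftrightarrow>
     0 < \<rho> \<and> fps_nth F 0 = 0 \<and>
     (\<forall>\<^sub>F n in sequentially. 0 < fps_nth F n) \<and>
     (\<lambda>n. fps_nth F (n - 1) / fps_nth F n) \<longlonglongrightarrow> \<rho> \<and>
     summable (\<lambda>k. fps_nth F k * \<rho> ^ k) \<and>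
     (\<lambda>n. (\<Sum>k=1..n. fps_nth F k * fps_nth F (n - k)) / fps_nth F n)
       \<longlonglongrightarrow> 2 * eval_fps F \<rho>"

definition min_size :: "'a set \<Rightarrow> ('a \<Rightarrow> nat) \<Rightarrow> nat" where
  "min_size C sz = (LEAST k. 1 \<le> k \<and> 0 < card {x \<in> C. sz x = k})"

text \<open>The number of components \<open>\<kappa>(G)\<close>, counted with multiplicity, is the library's
  \<open>size G\<close>.\<close>

definition total_size :: "('a \<Rightarrow> nat) \<Rightarrow> 'a multiset \<Rightarrow> nat" where
  "total_size sz G = (\<Sum>x\<in>#G. sz x)"

definition largest_component :: "('a \<Rightarrow> nat) \<Rightarrow> 'a multiset \<Rightarrow> nat" where
  "largest_component sz G = Max (sz ` set_mset G)"

definition class_multisets ::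
    "'a set \<Rightarrow> ('a \<Rightarrow> nat) \<Rightarrow> nat \<Rightarrow> nat \<Rightarrow> 'a multiset set" where
  "class_multisets C sz n N =
     {G. set_mset G \<subseteq> C \<and> total_size sz G = n \<and> size G = N}"

text \<open>\<open>X\<^sub>i = \<O>\<^sub>p(1)\<close>, where \<open>X i\<close> is a random variable on the probability space \<open>M i\<close>.\<close>

definition stochastically_bounded :: "(nat \<Rightarrow> 'b pmf) \<Rightarrow> (nat \<Rightarrow> 'b \<Rightarrow> real) \<Rightarrow> bool" where
  "stochastically_bounded M X \<longleftrightarrow>
     (\<forall>\<epsilon>::real. \<epsilon> > 0 \<longrightarrow> (\<exists>K::real. K > 0 \<and>
        limsup (\<lambda>i. ereal (measure_pmf.prob (M i) {\<omega>. \<bar>X i \<omega>\<bar> \<ge> K})) \<le> ereal \<epsilon>))"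

end

theory Submission
  imports Defs
begin

text \<open>Write \<open>s = n - mN\<close> and call \<open>|C| - m\<close> the excess of a component; the total excess of a
  multiset in \<open>\<G>\<^sub>n\<^sub>,\<^sub>N\<close> is \<open>s\<close>, so no component exceeds \<open>s + m\<close> and only the
  lower tail of the largest component matters. Let \<open>h(N)\<close> count the multisets of \<open>N\<close> components of
  size \<open>m\<close>. One component of excess \<open>s\<close> together with \<open>N - 1\<close> of size \<open>m\<close> gives at least
  \<open>c\<^sub>s\<^sub>+\<^sub>m h(N - 1) \<ge> c\<^sub>s\<^sub>+\<^sub>m h(N) / c\<^sub>m\<close> multisets, while those without a
  component of excess above \<open>s - K\<close> number at most \<open>h(N)\<close> times the multisets of components of
  positive excess, each at most \<open>s - K\<close>, with total excess \<open>s\<close> and an arbitrary number of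
  components. So \<open>N\<close> drops out, and the latter count has to be shown small against
  \<open>u\<^sub>s \<sim> c\<^sub>s\<^sub>+\<^sub>m\<close>.

  If \<open>A\<^sub>s\<close> counts all multisets of total excess \<open>s\<close>, marking a component gives
  \<open>s A\<^sub>s \<le> B \<Sum>\<^sub>j j u\<^sub>j A\<^sub>s\<^sub>-\<^sub>j\<close>. Subexponentiality makes the sum over
  \<open>j \<le> s - K\<close> contribute at most \<open>\<epsilon> s u\<^sub>s max\<^sub>r\<^sub><\<^sub>s A\<^sub>r / u\<^sub>r\<close>, whence
  \<open>A\<^sub>s = O(u\<^sub>s)\<close> by induction. The same estimate applied to the truncated recurrence then gives
  the smallness.\<close>

section \<open>Multisets of prescribed total size and their recurrence\<close>

definition sized_multisets :: "'a set \<Rightarrow> ('a \<Rightarrow> nat) \<Rightarrow> nat \<Rightarrow> 'a multiset set" where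
  "sized_multisets C sz s = {G. set_mset G \<subseteq> C \<and> total_size sz G = s}"

lemma total_size_empty [simp]: "total_size sz {#} = 0"
  by (simp add: total_size_def)

lemma total_size_add_mset [simp]: "total_size sz (add_mset x G) = sz x + total_size sz G"
  by (simp add: total_size_def)

lemma total_size_union [simp]: "total_size sz (G + H) = total_size sz G + total_size sz H"
  by (simp add: total_size_def)

lemma total_size_replicate_mset [simp]: "total_size sz (replicate_mset i x) = i * sz x"
  by (induction i) simp_all

lemma total_size_conv_sum:
  assumes "finite X" "set_mset G \<subseteq> X"
  shows "total_size sz G = (\<Sum>x\<in>X. count G x * sz x)"
  using assms(2)
proof (induction G)
  case (add y G)
  have "(\<Sum>x\<in>X. count (add_mset y G) x * sz x)
      = (\<Sum>x\<in>X. count G x * sz x + (if x = y then sz x else 0))"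
    by (intro sum.cong) auto
  also have "\<dots> = (\<Sum>x\<in>X. count G x * sz x) + sz y"
    using add.prems assms(1) by (simp add: sum.distrib)
  finally show ?case using add by simp
qed simp

lemma count_mult_le_total_size: "count G x * sz x \<le> total_size sz G"
  by (induction G) auto

lemma size_le_total_size: "(\<And>x. x \<in># G \<Longrightarrow> 1 \<le> sz x) \<Longrightarrow> size G \<le> total_size sz G"
proof (induction G)
  case (add x G)
  from add.prems[of x] add.IH add.prems show ?case by fastforce
qed simp

lemma sz_le_total_size: "x \<in># G \<Longrightarrow> sz x \<le> total_size sz G"
  by (induction G) auto

lemma finite_size_le:
  assumes "combinatorial_class C sz"
  shows "finite {x \<in> C. sz x \<le> D}"
proof -
  have "{x \<in> C. sz x \<le> D} = (\<Union>k\<le>D. {x \<in> C. sz x = k})" by auto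
  then show ?thesis using assms by (auto simp: combinatorial_class_def)
qed

lemma finite_sized_multisets:
  assumes "combinatorial_class C sz"
  shows "finite (sized_multisets C sz s)"
proof (rule finite_subset)
  show "sized_multisets C sz s \<subseteq> (\<Union>k\<le>s. multisets_of_size {x \<in> C. sz x \<le> s} k)"
  proof
    fix G assume G: "G \<in> sized_multisets C sz s"
    then have "size G \<le> s"
      using assms size_le_total_size[of G sz]
      by (auto simp: sized_multisets_def combinatorial_class_def)
    moreover have "set_mset G \<subseteq> {x \<in> C. sz x \<le> s}"
      using G sz_le_total_size[of _ G sz] by (auto simp: sized_multisets_def)
    ultimately show "G \<in> (\<Union>k\<le>s. multisets_of_size {x \<in> C. sz x \<le> s} k)"
      by (auto simp: multisets_of_size_def)
  qed
  show "finite (\<Union>k\<le>s. multisets_of_size {x \<in> C. sz x \<le> s} k)"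
    using finite_size_le[OF assms] by blast
qed

lemma sized_multisets_mono: "C \<subseteq> C' \<Longrightarrow> sized_multisets C sz s \<subseteq> sized_multisets C' sz s"
  by (auto simp: sized_multisets_def)

text \<open>Removing \<open>i\<close> copies of \<open>x\<close> is injective and lowers the total
  size by \<open>i * sz x\<close>. Nothing is left to count when this exceeds \<open>s\<close>. What
  remains is counted over all of \<open>C\<close>, so a size restriction on \<open>B\<close> is
  deliberately forgotten there.\<close>

lemma card_count_ge_le:
  assumes C: "combinatorial_class C sz" and B: "B \<subseteq> C"
  shows "card {G \<in> sized_multisets B sz s. i \<le> count G x}
      \<le> (if i * sz x \<le> s then card (sized_multisets C sz (s - i * sz x)) else 0)"
proof (cases "i * sz x \<le> s")
  case True
  have "card {G \<in> sized_multisets B sz s. i \<le> count G x}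
      \<le> card (sized_multisets C sz (s - i * sz x))"
  proof (rule card_inj_on_le)
    show "inj_on (\<lambda>G. G - replicate_mset i x) {G \<in> sized_multisets B sz s. i \<le> count G x}"
      by (rule inj_on_inverseI[where g = "\<lambda>G. G + replicate_mset i x"])
        (simp add: count_le_replicate_mset_subset_eq subset_mset.diff_add)
    show "(\<lambda>G. G - replicate_mset i x) ` {G \<in> sized_multisets B sz s. i \<le> count G x}
        \<subseteq> sized_multisets C sz (s - i * sz x)"
    proof safe
      fix G assume G: "G \<in> sized_multisets B sz s" "i \<le> count G x"
      have "G = G - replicate_mset i x + replicate_mset i x"
        using G(2) by (simp add: count_le_replicate_mset_subset_eq subset_mset.diff_add)
      then have "total_size sz G = total_size sz (G - replicate_mset i x) + i * sz x"
        by (metis total_size_union total_size_replicate_mset)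
      then show "G - replicate_mset i x \<in> sized_multisets C sz (s - i * sz x)"
        using G(1) B by (auto simp: sized_multisets_def dest: in_diffD)
    qed
  qed (rule finite_sized_multisets[OF C])
  with True show ?thesis by simp
next
  case False
  have "count G x * sz x \<le> s" if "G \<in> sized_multisets B sz s" for G
    using that count_mult_le_total_size[of G x sz] by (simp add: sized_multisets_def)
  then have "{G \<in> sized_multisets B sz s. i \<le> count G x} = {}"
    using False by (auto dest: mult_le_mono1[where k = "sz x"] le_trans)
  then have "card {G \<in> sized_multisets B sz s. i \<le> count G x} = 0"
    by (simp only: card.empty)
  then show ?thesis by simp
qed

lemma sum_multiples:
  fixes g :: "nat \<Rightarrow> 'b::comm_monoid_add"
  assumes "d \<ge> 1"
  shows "(\<Sum>i=1..s. if i * d \<le> s then g (i * d) else 0) = (\<Sum>j=1..s. if d dvd j then g j else 0)"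
proof -
  have "(\<Sum>i=1..s. if i * d \<le> s then g (i * d) else 0) = (\<Sum>i\<in>{i\<in>{1..s}. i * d \<le> s}. g (i * d))"
    by (rule sum.inter_filter[symmetric]) simp
  also have "\<dots> = (\<Sum>j\<in>{j\<in>{1..s}. d dvd j}. g j)"
  proof (rule sum.reindex_bij_witness[where i = "\<lambda>j. j div d" and j = "\<lambda>i. i * d"])
    fix j assume "j \<in> {j \<in> {1..s}. d dvd j}"
    then show "j div d \<in> {i \<in> {1..s}. i * d \<le> s}"
      using assms by (auto elim!: dvdE simp: Suc_le_eq intro: order_trans[rotated])
  qed (use assms in auto)
  also have "\<dots> = (\<Sum>j=1..s. if d dvd j then g j else 0)"
    by (rule sum.inter_filter) simp
  finally show ?thesis .
qed

text \<open>Double counting of the pairs of a multiset and one of its occurrences of a component \<open>x\<close>,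
  weighted by \<open>sz x\<close>. The \<open>i\<close>-th occurrence of a component of size \<open>d\<close> accounts for
  the summand \<open>j = i * d\<close>.\<close>

lemma sized_multisets_recurrence:
  assumes C: "combinatorial_class C sz"
  shows "s * card (sized_multisets {x \<in> C. sz x \<le> D} sz s)
    \<le> (\<Sum>j=1..s. card (sized_multisets C sz (s - j)) *
          (\<Sum>d\<in>{d\<in>{1..D}. d dvd j}. d * card {x \<in> C. sz x = d}))"
proof -
  define X where "X = {x \<in> C. sz x \<le> D}"
  define F where "F = sized_multisets X sz s"
  define A where "A j = card (sized_multisets C sz j)" for j
  define h where "h d = (\<Sum>j=1..s. if d dvd j then d * A (s - j) else 0)" for d
  have X: "finite X" "X \<subseteq> C" unfolding X_def using finite_size_le[OF C] by auto
  have pos: "1 \<le> sz x" if "x \<in> X" for x using that X C by (auto simp: combinatorial_class_def)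
  have F: "finite F"
    unfolding F_def using finite_sized_multisets[OF C] sized_multisets_mono[OF X(2)]
    by (rule rev_finite_subset)
  \<comment> \<open>Each occurrence of \<open>x\<close> becomes one summand. The range up to
    \<open>s\<close> does not depend on \<open>G\<close> and misses no occurrence, because
    \<open>1 \<le> sz x\<close> forces \<open>count G x \<le> s\<close>; the sums can then be
    interchanged.\<close>
  have cnt: "count G x * sz x = (\<Sum>i=1..s. if i \<le> count G x then sz x else 0)"
    if "G \<in> F" "x \<in> X" for G x
  proof -
    have "count G x * sz x \<le> s"
      using that count_mult_le_total_size[of G x sz] by (simp add: F_def sized_multisets_def)
    then have "count G x \<le> s" using pos[OF that(2)] by (cases "sz x") auto
    then have "{i \<in> {1..s}. i \<le> count G x} = {1..count G x}" by auto
    then show ?thesis using sum.inter_filter[of "{1..s}" "\<lambda>_. sz x" "\<lambda>i. i \<le> count G x"]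
      by simp
  qed
  have "s * card F = (\<Sum>G\<in>F. \<Sum>x\<in>X. count G x * sz x)"
  proof -
    have "(\<Sum>x\<in>X. count G x * sz x) = s" if "G \<in> F" for G
      using that total_size_conv_sum[OF X(1), of G sz] by (simp add: F_def sized_multisets_def)
    then show ?thesis by simp
  qed
  also have "\<dots> = (\<Sum>G\<in>F. \<Sum>x\<in>X. \<Sum>i=1..s. if i \<le> count G x then sz x else 0)"
    using cnt by simp
  also have "\<dots> = (\<Sum>x\<in>X. \<Sum>i=1..s. \<Sum>G\<in>F. if i \<le> count G x then sz x else 0)"
    by (subst sum.swap, intro sum.cong refl sum.swap)
  also have "\<dots> = (\<Sum>x\<in>X. \<Sum>i=1..s. sz x * card {G \<in> F. i \<le> count G x})"
    by (simp only: sum.inter_filter[OF F, symmetric] sum_constant) (simp add: mult.commute)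
  also have "\<dots> \<le> (\<Sum>x\<in>X. \<Sum>i=1..s. if i * sz x \<le> s then sz x * A (s - i * sz x) else 0)"
  proof (intro sum_mono)
    fix x i
    have "sz x * card {G \<in> F. i \<le> count G x} \<le> sz x * (if i * sz x \<le> s then A (s - i * sz x) else 0)"
      unfolding F_def A_def by (intro mult_left_mono card_count_ge_le C X) simp
    then show "sz x * card {G \<in> F. i \<le> count G x}
        \<le> (if i * sz x \<le> s then sz x * A (s - i * sz x) else 0)"
      by (cases "i * sz x \<le> s") simp_all
  qed
  also have "\<dots> = (\<Sum>x\<in>X. h (sz x))"
    unfolding h_def by (intro sum.cong refl sum_multiples pos)
  also have "\<dots> = (\<Sum>d=1..D. \<Sum>x\<in>{x\<in>X. sz x = d}. h (sz x))"
    using X pos by (intro sum.group[symmetric]) (auto simp: X_def)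
  also have "\<dots> = (\<Sum>d=1..D. card {x \<in> C. sz x = d} * h d)"
  proof (intro sum.cong refl)
    fix d assume "d \<in> {1..D}"
    then have "{x \<in> X. sz x = d} = {x \<in> C. sz x = d}" by (auto simp: X_def)
    then show "(\<Sum>x\<in>{x\<in>X. sz x = d}. h (sz x)) = card {x \<in> C. sz x = d} * h d" by simp
  qed
  also have "\<dots> = (\<Sum>j=1..s. \<Sum>d=1..D. if d dvd j then A (s - j) * (d * card {x \<in> C. sz x = d}) else 0)"
    unfolding h_def sum_distrib_left by (subst sum.swap) (auto intro!: sum.cong)
  also have "\<dots> = (\<Sum>j=1..s. A (s - j) * (\<Sum>d\<in>{d\<in>{1..D}. d dvd j}. d * card {x \<in> C. sz x = d}))"
    by (simp only: sum.inter_filter[OF finite_atLeastAtMost] sum_distrib_left[symmetric])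
       (simp only: sum_distrib_left if_distrib[where f = "(*) _"] mult_zero_right)
  finally show ?thesis by (simp add: F_def X_def A_def)
qed

section \<open>Convolution estimates for heavy-tailed weights\<close>

text \<open>These are the consequences of subexponentiality that the counting uses.
  \<open>ratio\<close> compares \<open>u\<close> at bounded distance, and \<open>middle\<close> says
  that a convolution of \<open>u\<close> with itself is carried by its two ends.\<close>

locale heavy_tailed_weight =
  fixes u :: "nat \<Rightarrow> real" and R :: real
  assumes pos: "0 < u j"
    and ratio: "u s \<le> R * u (Suc s)"
    and middle: "0 < e \<Longrightarrow> \<exists>K. \<forall>\<^sub>F s in sequentially. (\<Sum>j=K..s-K. u j * u (s - j)) \<le> e * u s"
begin

lemma R_pos: "0 < R"
  using pos[of 0] pos[of "Suc 0"] ratio[of 0] by (metis less_le_trans zero_less_mult_pos2)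

lemma ratio_power: "u s \<le> R ^ j * u (s + j)"
proof (induction j)
  case (Suc j)
  have "R ^ j * u (s + j) \<le> R ^ j * (R * u (Suc (s + j)))"
    using R_pos by (intro mult_left_mono ratio) simp
  with Suc show ?case by (simp add: algebra_simps)
qed simp

lemma shift_le: "j \<le> s \<Longrightarrow> u (s - j) \<le> R ^ j * u s"
  using ratio_power[of "s - j" j] by simp

text \<open>The factor \<open>j\<close>, compared with \<open>s\<close>, makes the summands with \<open>j\<close> bounded negligible,
  so that only those with \<open>s - j\<close> bounded have to be excluded.\<close>

lemma weighted_convolution_small:
  assumes e: "0 < e"
  shows "\<exists>K\<ge>1. \<forall>\<^sub>F s in sequentially. (\<Sum>j=1..s-K. real j * u j * u (s - j)) \<le> e * real s * u s"
proof -
  obtain K0 where K0: "\<forall>\<^sub>F s in sequentially. (\<Sum>j=K0..s-K0. u j * u (s - j)) \<le> e / 2 * u s"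
    using middle[of "e / 2"] e by auto
  define K where "K = max K0 1"
  define P where "P = (\<Sum>j<K. real j * u j * R ^ j)"
  have "\<forall>\<^sub>F s in sequentially. (\<Sum>j=1..s-K. real j * u j * u (s - j)) \<le> e * real s * u s"
    using K0 eventually_ge_at_top[of "2 * K"] eventually_ge_at_top[of "nat \<lceil>2 * P / e\<rceil>"]
  proof eventually_elim
    case (elim s)
    \<comment> \<open>The first \<open>K\<close> summands amount to at most the constant
      \<open>P\<close> times \<open>u s\<close>; they are absorbed as soon as \<open>s\<close> is at
      least \<open>2 * P / e\<close>.\<close>
    have "2 * P / e \<le> real s" using elim(3) by linarith
    then have P: "P \<le> e / 2 * real s" using e by (simp add: field_simps)
    have "(\<Sum>j=1..s-K. real j * u j * u (s - j)) \<le> (\<Sum>j\<in>{..<K} \<union> {K..s-K}. real j * u j * u (s - j))"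
      using pos by (intro sum_mono2) (auto simp: less_imp_le)
    also have "\<dots> = (\<Sum>j<K. real j * u j * u (s - j)) + (\<Sum>j=K..s-K. real j * u j * u (s - j))"
      by (intro sum.union_disjoint) auto
    also have "(\<Sum>j<K. real j * u j * u (s - j)) \<le> (\<Sum>j<K. real j * u j * (R ^ j * u s))"
      using pos elim(2) by (intro sum_mono mult_left_mono shift_le) (auto simp: less_imp_le)
    also have "\<dots> = P * u s" by (simp add: P_def sum_distrib_left algebra_simps)
    also have "\<dots> \<le> e / 2 * real s * u s" using P pos[of s] by (intro mult_right_mono) auto
    also have "(\<Sum>j=K..s-K. real j * u j * u (s - j)) \<le> (\<Sum>j=K..s-K. real s * (u j * u (s - j)))"
      unfolding mult.assoc using pos by (intro sum_mono mult_right_mono) (auto simp: less_imp_le)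
    also have "\<dots> = real s * (\<Sum>j=K..s-K. u j * u (s - j))" by (simp add: sum_distrib_left)
    also have "\<dots> \<le> real s * (\<Sum>j=K0..s-K0. u j * u (s - j))"
      using pos by (intro mult_left_mono sum_mono2) (auto simp: K_def less_imp_le)
    also have "\<dots> \<le> real s * (e / 2 * u s)" using elim(1) by (intro mult_left_mono) auto
    finally show ?case by (simp add: algebra_simps)
  qed
  moreover have "K \<ge> 1" by (simp add: K_def)
  ultimately show ?thesis by blast
qed

lemma recurrence_bounded:
  fixes A :: "nat \<Rightarrow> real"
  assumes B: "0 < B" and A: "\<And>s. 0 \<le> A s"
    and rec: "\<And>s. real s * A s \<le> B * (\<Sum>j=1..s. real j * u j * A (s - j))"
  obtains M where "0 < M" "\<And>s. A s \<le> M * u s"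
proof -
  obtain K s0 where K: "K \<ge> 1"
    and conv: "\<And>s. s \<ge> s0 \<Longrightarrow> (\<Sum>j=1..s-K. real j * u j * u (s - j)) \<le> 1 / (2 * B) * real s * u s"
    using weighted_convolution_small[of "1 / (2 * B)"] B by (auto simp: eventually_sequentially)
  define Q where "Q = B * (\<Sum>r<K. R ^ r * A r)"
  define s1 where "s1 = max s0 K"
  \<comment> \<open>In the induction step, the summands with \<open>s - j\<close> at least
    \<open>K\<close> return \<open>M / 2\<close>, by the choice of \<open>1 / (2 * B)\<close> above,
    and the others add at most \<open>Q\<close>. Hence \<open>2 * Q \<le> M\<close> closes the
    induction; the sum over \<open>r < s1\<close> covers the initial values.\<close>
  define M where "M = 2 * Q + (\<Sum>r<s1. A r / u r) + 1"
  have nonneg: "0 \<le> Q" "0 \<le> (\<Sum>r<s1. A r / u r)"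
    unfolding Q_def using A B R_pos pos by (auto intro!: mult_nonneg_nonneg sum_nonneg simp: less_imp_le)
  have "A s \<le> M * u s" for s
  proof (induction s rule: less_induct)
    case (less s)
    show ?case
    proof (cases "s < s1")
      case True
      have "A s / u s \<le> (\<Sum>r<s1. A r / u r)"
        using True A pos by (intro member_le_sum) (auto simp: less_imp_le)
      then have "A s / u s \<le> M" using nonneg by (simp add: M_def)
      then show ?thesis using pos[of s] by (simp add: field_simps)
    next
      case False
      then have s: "s0 \<le> s" "K \<le> s" "0 < s" using K by (auto simp: s1_def)
      have M: "0 \<le> M" using nonneg by (simp add: M_def)
      have "(\<Sum>j=1..s. real j * u j * A (s - j))
          = (\<Sum>j=1..s-K. real j * u j * A (s - j)) + (\<Sum>j=Suc (s-K)..s. real j * u j * A (s - j))"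
        using s sum.ub_add_nat[of 1 "s - K" "\<lambda>j. real j * u j * A (s - j)" K] by simp
      also have "(\<Sum>j=1..s-K. real j * u j * A (s - j)) \<le> (\<Sum>j=1..s-K. real j * u j * (M * u (s - j)))"
        using pos s K by (intro sum_mono mult_left_mono less.IH) (auto simp: less_imp_le)
      also have "\<dots> = M * (\<Sum>j=1..s-K. real j * u j * u (s - j))"
        by (simp add: sum_distrib_left algebra_simps)
      also have "\<dots> \<le> M * (1 / (2 * B) * real s * u s)"
        using M conv[OF s(1)] by (intro mult_left_mono) auto
      also have "(\<Sum>j=Suc (s-K)..s. real j * u j * A (s - j)) = (\<Sum>r<K. real (s - r) * u (s - r) * A r)"
        using s by (intro sum.reindex_bij_witness[where i = "\<lambda>r. s - r" and j = "\<lambda>j. s - j"]) auto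
      also have "\<dots> \<le> (\<Sum>r<K. real s * (R ^ r * u s) * A r)"
        using A pos s by (intro sum_mono mult_right_mono mult_mono shift_le) (auto simp: less_imp_le)
      also have "\<dots> = real s * u s * (\<Sum>r<K. R ^ r * A r)"
        by (simp add: sum_distrib_left algebra_simps)
      finally have "(\<Sum>j=1..s. real j * u j * A (s - j))
          \<le> M * (1 / (2 * B) * real s * u s) + real s * u s * (\<Sum>r<K. R ^ r * A r)" by simp
      with rec[of s] have "real s * A s
          \<le> B * (M * (1 / (2 * B) * real s * u s) + real s * u s * (\<Sum>r<K. R ^ r * A r))"
        using B by (meson mult_left_mono order_less_imp_le order_trans)
      also have "\<dots> = real s * ((M / 2 + Q) * u s)"
        using B by (simp add: Q_def field_simps)
      finally have "A s \<le> (M / 2 + Q) * u s" using s by simp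
      also have "\<dots> \<le> M * u s"
        using nonneg pos[of s] by (intro mult_right_mono) (auto simp: M_def)
      finally show ?thesis .
    qed
  qed
  moreover have "0 < M" using nonneg by (simp add: M_def)
  ultimately show ?thesis using that by blast
qed

text \<open>In the truncated recurrence, the part \<open>j \<le> s - K\<close> is a weighted
  convolution once \<open>A\<close> is bounded by a multiple of \<open>u\<close>. For
  \<open>j > s - K\<close> the truncation excludes the divisor \<open>d = j\<close>, so every
  remaining divisor is at most \<open>s div 2\<close> and \<open>half\<close> makes its contribution
  negligible; only the finitely many values \<open>A r\<close> with \<open>r < K\<close> occur as
  factors.\<close>

lemma card_bounded_components_small:
  assumes C: "combinatorial_class C sz" and B: "0 < B"
    and sums: "\<And>j. (\<Sum>d=1..j. real (card {x \<in> C. sz x = d})) \<le> B * u j"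
    and half: "\<And>e. 0 < e \<Longrightarrow> \<forall>\<^sub>F s in sequentially. u (s div 2) \<le> e * u s"
    and e: "0 < e"
  shows "\<exists>K. \<forall>\<^sub>F s in sequentially.
    real (card (sized_multisets {x \<in> C. sz x \<le> s - K} sz s)) \<le> e * u s"
proof -
  define b where "b d = real (card {x \<in> C. sz x = d})" for d
  define A where "A s = real (card (sized_multisets C sz s))" for s
  have A: "0 \<le> A s" and b: "0 \<le> b s" for s by (simp_all add: A_def b_def)
  have rec: "real s * real (card (sized_multisets {x \<in> C. sz x \<le> D} sz s))
      \<le> (\<Sum>j=1..s. A (s - j) * (\<Sum>d\<in>{d\<in>{1..D}. d dvd j}. real d * b d))" for s D
    using sized_multisets_recurrence[OF C, THEN of_nat_mono[where 'a = real], of s D]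
    by (simp add: A_def b_def)
  \<comment> \<open>Here \<open>l\<close> bounds the divisors and \<open>k\<close> the weight
    \<open>d\<close>. The two uses are \<open>k = l = j\<close>, and \<open>k = s\<close> with
    \<open>l = s div 2\<close>.\<close>
  have div_sum: "(\<Sum>d\<in>{d\<in>{1..D}. d dvd j}. real d * b d) \<le> real k * (B * u l)"
    if "\<And>d. d dvd j \<Longrightarrow> 1 \<le> d \<Longrightarrow> d \<le> D \<Longrightarrow> d \<le> l" "l \<le> k" for j k l D
  proof -
    have "(\<Sum>d\<in>{d\<in>{1..D}. d dvd j}. real d * b d) \<le> (\<Sum>d=1..l. real d * b d)"
      using that b by (intro sum_mono2) auto
    also have "\<dots> \<le> (\<Sum>d=1..l. real k * b d)"
      using that b by (intro sum_mono mult_right_mono) auto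
    also have "\<dots> \<le> real k * (B * u l)"
      using sums[of l] by (simp add: b_def mult_left_mono flip: sum_distrib_left)
    finally show ?thesis .
  qed
  have div_sum': "(\<Sum>d\<in>{d\<in>{1..D}. d dvd j}. real d * b d) \<le> real j * (B * u j)" if "1 \<le> j" for j D
    using that by (intro div_sum) (auto dest: dvd_imp_le)
  have "real s * A s \<le> B * (\<Sum>j=1..s. real j * u j * A (s - j))" for s
  proof -
    have "sized_multisets {x \<in> C. sz x \<le> s} sz s = sized_multisets C sz s"
      using sz_le_total_size[of _ _ sz] by (auto simp: sized_multisets_def)
    then have "real s * A s \<le> (\<Sum>j=1..s. A (s - j) * (\<Sum>d\<in>{d\<in>{1..s}. d dvd j}. real d * b d))"
      using rec[of s s] by (simp add: A_def)
    also have "\<dots> \<le> (\<Sum>j=1..s. A (s - j) * (real j * (B * u j)))"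
      using A by (intro sum_mono mult_left_mono div_sum') auto
    also have "\<dots> = B * (\<Sum>j=1..s. real j * u j * A (s - j))"
      by (simp add: sum_distrib_left algebra_simps)
    finally show ?thesis .
  qed
  then obtain M where M: "0 < M" "\<And>s. A s \<le> M * u s"
    using recurrence_bounded[OF B, of A] A by blast
  obtain K where K: "K \<ge> 1" and conv: "\<forall>\<^sub>F s in sequentially.
      (\<Sum>j=1..s-K. real j * u j * u (s - j)) \<le> e / (2 * B * M) * real s * u s"
    using weighted_convolution_small[of "e / (2 * B * M)"] B M(1) e by auto
  \<comment> \<open>The added 1 makes \<open>Q\<close> positive, so that it can serve as a
    denominator.\<close>
  define Q where "Q = (\<Sum>r<K. A r) + 1"
  have Q: "0 < Q" unfolding Q_def using A by (intro add_nonneg_pos sum_nonneg) auto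
  have "\<forall>\<^sub>F s in sequentially. u (s div 2) \<le> e / (2 * B * Q) * u s"
    using half[of "e / (2 * B * Q)"] B Q e by auto
  then have "\<forall>\<^sub>F s in sequentially.
      real (card (sized_multisets {x \<in> C. sz x \<le> s - K} sz s)) \<le> e * u s"
    using conv eventually_ge_at_top[of K]
  proof eventually_elim
    case (elim s)
    define S where "S j = (\<Sum>d\<in>{d\<in>{1..s-K}. d dvd j}. real d * b d)" for j
    have s: "0 < s" using elim(3) K by simp
    have "(\<Sum>j=1..s-K. A (s - j) * S j) \<le> (\<Sum>j=1..s-K. (M * u (s - j)) * (real j * (B * u j)))"
      unfolding S_def using A b pos M B
      by (intro sum_mono mult_mono div_sum' sum_nonneg mult_nonneg_nonneg) (auto simp: less_imp_le)
    also have "\<dots> = B * M * (\<Sum>j=1..s-K. real j * u j * u (s - j))"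
      by (simp add: sum_distrib_left algebra_simps)
    also have "\<dots> \<le> B * M * (e / (2 * B * M) * real s * u s)"
      using elim(2) B M(1) by (intro mult_left_mono) auto
    also have "\<dots> = real s * (e / 2 * u s)" using B M(1) by (simp add: field_simps)
    finally have low: "(\<Sum>j=1..s-K. A (s - j) * S j) \<le> real s * (e / 2 * u s)" .
    have "(\<Sum>j=Suc (s-K)..s. A (s - j) * S j) \<le> (\<Sum>j=Suc (s-K)..s. A (s - j) * (real s * (B * u (s div 2))))"
    proof (intro sum_mono mult_left_mono A)
      fix j assume j: "j \<in> {Suc (s-K)..s}"
      show "S j \<le> real s * (B * u (s div 2))"
        unfolding S_def
      proof (rule div_sum)
        fix d assume d: "d dvd j" "1 \<le> d" "d \<le> s - K"
        then obtain i where i: "j = d * i" by blast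
        have "i \<noteq> 0" "i \<noteq> 1" using i j d by (auto intro!: Nat.gr0I)
        then have "2 * d \<le> d * i" by (cases i) auto
        then have "2 * d \<le> j" using i by simp
        then show "d \<le> s div 2" using j by auto
      qed simp
    qed
    also have "\<dots> = (\<Sum>r<K. A r) * (real s * (B * u (s div 2)))"
      unfolding sum_distrib_right using elim(3)
      by (intro sum.reindex_bij_witness[where i = "\<lambda>r. s - r" and j = "\<lambda>j. s - j"]) auto
    also have "\<dots> \<le> Q * (real s * (B * (e / (2 * B * Q) * u s)))"
      using elim(1) B pos Q by (intro mult_mono mult_nonneg_nonneg) (auto simp: Q_def less_imp_le)
    also have "\<dots> = real s * (e / 2 * u s)" using B Q by (simp add: field_simps)
    finally have high: "(\<Sum>j=Suc (s-K)..s. A (s - j) * S j) \<le> real s * (e / 2 * u s)" .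
    have "(\<Sum>j=1..s. A (s - j) * S j) = (\<Sum>j=1..s-K. A (s - j) * S j) + (\<Sum>j=Suc (s-K)..s. A (s - j) * S j)"
      using elim(3) sum.ub_add_nat[of 1 "s - K" "\<lambda>j. A (s - j) * S j" K] by simp
    then have "real s * real (card (sized_multisets {x \<in> C. sz x \<le> s - K} sz s)) \<le> real s * (e * u s)"
      using low high rec[of s "s - K"] by (simp add: S_def field_simps)
    then show ?case using s by simp
  qed
  then show ?thesis by blast
qed

end

section \<open>From subexponential series to heavy-tailed weights\<close>

lemma shifted_ratio_tendsto:
  fixes c :: "nat \<Rightarrow> real"
  assumes pos: "\<forall>\<^sub>F n in sequentially. 0 < c n"
    and lim: "(\<lambda>n. c (n - 1) / c n) \<longlonglongrightarrow> \<rho>"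
  shows "(\<lambda>n. c (n - k) / c n) \<longlonglongrightarrow> \<rho> ^ k"
proof (induction k)
  case 0
  have "\<forall>\<^sub>F n in sequentially. c (n - 0) / c n = 1" using pos by eventually_elim simp
  then show ?case by (simp add: tendsto_eventually)
next
  case (Suc k)
  have shift: "filterlim (\<lambda>n. n - 1) sequentially sequentially"
    by (rule filterlim_minus_const_nat_at_top)
  have "(\<lambda>n. c (n - 1 - k) / c (n - 1) * (c (n - 1) / c n)) \<longlonglongrightarrow> \<rho> ^ k * \<rho>"
    by (intro tendsto_mult lim filterlim_compose[OF Suc shift])
  moreover have "\<forall>\<^sub>F n in sequentially.
      c (n - 1 - k) / c (n - 1) * (c (n - 1) / c n) = c (n - Suc k) / c n"
    using eventually_compose_filterlim[OF pos shift] by eventually_elim simp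
  ultimately show ?case unfolding power_Suc2 by (rule Lim_transform_eventually)
qed

text \<open>By symmetry the two end blocks of \<open>K\<close> terms are equal, and each, divided by
  the \<open>n\<close>-th coefficient, tends to the \<open>K\<close>-th partial sum of the series at
  \<rho>. The middle part therefore tends to twice the remaining tail. All large \<open>K\<close>
  are allowed because the window is later enlarged and shifted.\<close>

lemma subexponential_middle_small:
  assumes F: "subexponential F \<rho>" and e: "0 < e"
  shows "\<exists>K0. \<forall>K\<ge>K0. \<forall>\<^sub>F n in sequentially.
    (\<Sum>k=K..n-K. fps_nth F k * fps_nth F (n - k)) \<le> e * fps_nth F n"
proof -
  define c where "c = fps_nth F"
  have c0: "c 0 = 0" and pos: "\<forall>\<^sub>F n in sequentially. 0 < c n"
    and lim: "(\<lambda>n. c (n - 1) / c n) \<longlonglongrightarrow> \<rho>" and summ: "summable (\<lambda>k. c k * \<rho> ^ k)"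
    and conv: "(\<lambda>n. (\<Sum>k=1..n. c k * c (n - k)) / c n) \<longlonglongrightarrow> 2 * eval_fps F \<rho>"
    using F by (simp_all add: subexponential_def c_def)
  have "(\<lambda>K. \<Sum>k<K. c k * \<rho> ^ k) \<longlonglongrightarrow> eval_fps F \<rho>"
    using summable_LIMSEQ[OF summ] by (simp add: eval_fps_def c_def)
  then have "\<forall>\<^sub>F K in sequentially. eval_fps F \<rho> - e / 2 < (\<Sum>k<K. c k * \<rho> ^ k)"
    using e by (intro order_tendstoD) auto
  then obtain K0 where K0: "\<And>K. K \<ge> K0 \<Longrightarrow> eval_fps F \<rho> - e / 2 < (\<Sum>k<K. c k * \<rho> ^ k)"
    by (auto simp: eventually_sequentially)
  have "\<forall>\<^sub>F n in sequentially. (\<Sum>k=K..n-K. c k * c (n - k)) \<le> e * c n" if "K \<ge> K0" for K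
  proof -
    have "(\<lambda>n. (\<Sum>k=1..n. c k * c (n - k)) / c n - 2 * (\<Sum>k<K. c k * (c (n - k) / c n)))
        \<longlonglongrightarrow> 2 * eval_fps F \<rho> - 2 * (\<Sum>k<K. c k * \<rho> ^ k)"
      by (intro tendsto_intros conv shifted_ratio_tendsto pos lim)
    then have "\<forall>\<^sub>F n in sequentially.
        (\<Sum>k=1..n. c k * c (n - k)) / c n - 2 * (\<Sum>k<K. c k * (c (n - k) / c n)) < e"
      by (rule order_tendstoD) (use K0[OF that] in simp)
    then show ?thesis
      using pos eventually_ge_at_top[of "2 * K"]
    proof eventually_elim
      case (elim n)
      define g where "g k = c k * c (n - k)" for k
      \<comment> \<open>Including the vanishing term at 0 makes the range symmetric under
        \<open>k \<mapsto> n - k\<close>.\<close>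
      have "(\<Sum>k=1..n. g k) = (\<Sum>k=0..n. g k)"
        using c0 by (simp add: sum.atLeast_Suc_atMost g_def)
      also have "\<dots> = (\<Sum>k\<in>{..<K} \<union> {K..n-K} \<union> {Suc (n-K)..n}. g k)"
        using elim(3) by (intro sum.cong) auto
      also have "\<dots> = (\<Sum>k<K. g k) + (\<Sum>k=K..n-K. g k) + (\<Sum>k=Suc (n-K)..n. g k)"
        using elim(3) by (subst sum.union_disjoint; (subst sum.union_disjoint)?) auto
      also have "(\<Sum>k=Suc (n-K)..n. g k) = (\<Sum>k<K. g k)"
        using elim(3)
        by (intro sum.reindex_bij_witness[where i = "\<lambda>k. n - k" and j = "\<lambda>k. n - k"])
          (auto simp: g_def)
      finally have "(\<Sum>k=K..n-K. g k) = (\<Sum>k=1..n. g k) - 2 * (\<Sum>k<K. g k)" by simp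
      also have "\<dots> = ((\<Sum>k=1..n. g k) / c n - 2 * (\<Sum>k<K. c k * (c (n - k) / c n))) * c n"
      proof -
        have "(\<Sum>k<K. c k * (c (n - k) / c n)) * c n = (\<Sum>k<K. g k)"
          unfolding sum_distrib_right using elim(2) by (intro sum.cong) (auto simp: g_def)
        then show ?thesis using elim(2) by (simp add: left_diff_distrib mult.assoc)
      qed
      also have "\<dots> \<le> e * c n"
        using elim(1,2) by (intro mult_right_mono) (auto simp: g_def)
      finally show ?case by (simp add: g_def)
    qed
  qed
  then show ?thesis unfolding c_def by blast
qed

lemma geometric_growth_half:
  fixes u :: "nat \<Rightarrow> real"
  assumes \<theta>: "0 < \<theta>" "\<theta> < 1" and pos: "\<And>s. 0 < u s"
    and growth: "\<And>s. J \<le> s \<Longrightarrow> u s \<le> \<theta> * u (Suc s)" and e: "0 < e"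
  shows "\<forall>\<^sub>F s in sequentially. u (s div 2) \<le> e * u s"
proof -
  have pow: "u s \<le> \<theta> ^ j * u (s + j)" if "J \<le> s" for s j
  proof (induction j)
    case (Suc j)
    have "\<theta> ^ j * u (s + j) \<le> \<theta> ^ j * (\<theta> * u (Suc (s + j)))"
      using \<theta> that by (intro mult_left_mono growth) auto
    with Suc show ?case by (simp add: algebra_simps)
  qed simp
  obtain k where k: "\<theta> ^ k < e" using real_arch_pow_inv[OF e \<theta>(2)] by blast
  \<comment> \<open>This puts \<open>s div 2\<close> beyond \<open>J\<close> and leaves at least
    \<open>k\<close> growth steps from there to \<open>s\<close>.\<close>
  have "\<forall>\<^sub>F s in sequentially. 2 * (J + k) \<le> s" by (rule eventually_ge_at_top)
  then show ?thesis
  proof eventually_elim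
    case (elim s)
    have "u (s div 2) \<le> \<theta> ^ (s - s div 2) * u (s div 2 + (s - s div 2))"
      using elim by (intro pow) auto
    also have "\<dots> \<le> \<theta> ^ k * u s"
      using elim \<theta> pos[of s] by (auto intro!: mult_right_mono power_decreasing)
    also have "\<dots> \<le> e * u s" using k pos[of s] by (intro mult_right_mono) auto
    finally show ?case .
  qed
qed

lemma geometric_growth_sum:
  fixes u :: "nat \<Rightarrow> real"
  assumes \<theta>: "0 < \<theta>" "\<theta> < 1" and ge_1: "\<And>s. 1 \<le> u s"
    and growth: "\<And>s. J \<le> s \<Longrightarrow> u s \<le> \<theta> * u (Suc s)"
  shows "\<exists>B>0. \<forall>s. (\<Sum>d\<le>s. u d) \<le> B * u s"
proof -
  \<comment> \<open>The first summand bounds the sums up to \<open>J\<close>, as \<open>u\<close> is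
    at least 1. The second gives \<open>B * \<theta> + 1 \<le> B\<close>, which is what the
    induction step needs beyond \<open>J\<close>.\<close>
  define B where "B = (\<Sum>d\<le>J. u d) + 1 / (1 - \<theta>)"
  have "0 \<le> (\<Sum>d\<le>J. u d)"
    using ge_1 by (intro sum_nonneg) (auto intro: order_trans[OF zero_le_one])
  then have B: "1 / (1 - \<theta>) \<le> B" "(\<Sum>d\<le>J. u d) \<le> B"
    using \<theta> by (auto simp: B_def)
  have B0: "0 < B" using B(1) \<theta> by (smt (verit) divide_pos_pos)
  have "(\<Sum>d\<le>s. u d) \<le> B * u s" for s
  proof (induction s)
    case 0
    have "u 0 \<le> (\<Sum>d\<le>J. u d)"
      using ge_1 by (intro member_le_sum) (auto intro: order_trans[OF zero_le_one])
    then have "u 0 \<le> B" using B by simp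
    also have "\<dots> \<le> B * u 0" using mult_left_mono[OF ge_1[of 0], of B] B0 by simp
    finally show ?case by simp
  next
    case (Suc s)
    show ?case
    proof (cases "J \<le> s")
      case True
      have "1 \<le> B * (1 - \<theta>)" using B(1) \<theta> by (simp add: field_simps)
      then have "B * \<theta> + 1 \<le> B" by (simp add: algebra_simps)
      have "(\<Sum>d\<le>Suc s. u d) \<le> B * u s + u (Suc s)" using Suc by simp
      also have "\<dots> \<le> B * (\<theta> * u (Suc s)) + u (Suc s)"
        using growth[OF True] B0 by simp
      also have "\<dots> = (B * \<theta> + 1) * u (Suc s)" by (simp add: algebra_simps)
      also have "\<dots> \<le> B * u (Suc s)"
        using \<open>B * \<theta> + 1 \<le> B\<close> ge_1[of "Suc s"] by (intro mult_right_mono) auto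
      finally show ?thesis .
    next
      case False
      then have "(\<Sum>d\<le>Suc s. u d) \<le> (\<Sum>d\<le>J. u d)"
        using ge_1 by (intro sum_mono2) (auto intro: order_trans[OF zero_le_one])
      also have "\<dots> \<le> B * 1" using B by simp
      also have "\<dots> \<le> B * u (Suc s)" using ge_1 B0 by (intro mult_left_mono) auto
      finally show ?thesis .
    qed
  qed
  with B0 show ?thesis by blast
qed

text \<open>The shift by \<open>m\<close> passes from sizes to excesses. The maximum with 1 fills
  the finitely many gaps of the class, so that \<open>u\<close> is positive everywhere; since the
  coefficients are integers, it changes nothing for large indices.\<close>

lemma subexponential_integral_weight:
  fixes a :: "nat \<Rightarrow> nat" and u :: "nat \<Rightarrow> real"
  assumes F: "subexponential F \<rho>" and a: "\<And>n. fps_nth F n = real (a n)"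
    and u: "\<And>j. u j = max 1 (real (a (j + m)))"
  shows "\<exists>R. heavy_tailed_weight u R"
    and "\<exists>B>0. \<forall>s. (\<Sum>d\<le>s. u d) \<le> B * u s"
    and "0 < e \<Longrightarrow> \<forall>\<^sub>F s in sequentially. u (s div 2) \<le> e * u s"
    and "\<forall>\<^sub>F s in sequentially. u s = real (a (s + m))"
proof -
  define c where "c n = real (a n)" for n
  have c_F: "c n = fps_nth F n" for n by (simp add: c_def a)
  have \<rho>: "0 < \<rho>" and pos: "\<forall>\<^sub>F n in sequentially. 0 < c n"
    and lim: "(\<lambda>n. c (n - 1) / c n) \<longlonglongrightarrow> \<rho>" and summ: "summable (\<lambda>k. c k * \<rho> ^ k)"
    using F by (simp_all add: subexponential_def c_F)
  have ge_1: "\<forall>\<^sub>F n in sequentially. 1 \<le> c n"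
    using pos by eventually_elim (simp add: c_def)
  have u_ge_1: "1 \<le> u s" and u_pos: "0 < u s" for s by (simp_all add: u)
  have ev_shift: "filterlim (\<lambda>s. s + k) sequentially sequentially" for k :: nat
    by (rule filterlim_add_const_nat_at_top)
  show u_eq: "\<forall>\<^sub>F s in sequentially. u s = real (a (s + m))"
    using eventually_compose_filterlim[OF ge_1 ev_shift[of m]]
    by eventually_elim (simp add: u c_def)
  \<comment> \<open>Coefficients that are eventually at least 1 contradict summability when \<rho>
    is at least 1. Thus \<open>u\<close> grows geometrically, which yields the bounds on its partial
    sums and on \<open>u (s div 2)\<close>.\<close>
  have "\<rho> < 1"
  proof (rule ccontr)
    assume "\<not> \<rho> < 1"
    then have "\<forall>\<^sub>F n in sequentially. 1 \<le> c n * \<rho> ^ n"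
      using ge_1 by (auto elim!: eventually_mono intro: mult_ge1_I)
    moreover have "\<forall>\<^sub>F n in sequentially. c n * \<rho> ^ n < 1"
      using summable_LIMSEQ_zero[OF summ] by (rule order_tendstoD) simp
    ultimately have "\<forall>\<^sub>F n::nat in sequentially. False" by eventually_elim simp
    then show False by simp
  qed
  have "(\<lambda>s. c (s + Suc m - 1) / c (s + Suc m)) \<longlonglongrightarrow> \<rho>"
    by (rule filterlim_compose[OF lim ev_shift])
  moreover have "\<forall>\<^sub>F s in sequentially. c (s + Suc m - 1) / c (s + Suc m) = u s / u (Suc s)"
    using u_eq eventually_compose_filterlim[OF u_eq ev_shift[of 1]]
    by eventually_elim (simp add: c_def)
  ultimately have u_lim: "(\<lambda>s. u s / u (Suc s)) \<longlonglongrightarrow> \<rho>" by (simp add: tendsto_cong)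
  define \<theta> where "\<theta> = (1 + \<rho>) / 2"
  have \<theta>: "0 < \<theta>" "\<theta> < 1" "\<rho> < \<theta>" using \<rho> \<open>\<rho> < 1\<close> by (auto simp: \<theta>_def)
  have "\<forall>\<^sub>F s in sequentially. u s / u (Suc s) < \<theta>"
    using u_lim \<theta>(3) by (rule order_tendstoD)
  then obtain J where "\<And>s. J \<le> s \<Longrightarrow> u s / u (Suc s) < \<theta>"
    by (auto simp: eventually_sequentially)
  then have growth: "\<And>s. J \<le> s \<Longrightarrow> u s \<le> \<theta> * u (Suc s)"
    using u_pos by (simp add: divide_less_eq less_imp_le)
  show "\<exists>B>0. \<forall>s. (\<Sum>d\<le>s. u d) \<le> B * u s"
    using geometric_growth_sum[of \<theta> u J] \<theta> u_ge_1 growth by blast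
  show "\<forall>\<^sub>F s in sequentially. u (s div 2) \<le> e * u s" if "0 < e"
    using geometric_growth_half[of \<theta> u J] \<theta> u_pos growth that by blast
  have "Bseq (\<lambda>s. u s / u (Suc s))"
    using u_lim by (intro convergent_imp_Bseq convergentI)
  then obtain R where R: "\<And>s. norm (u s / u (Suc s)) \<le> R" by (auto simp: Bseq_def)
  have "heavy_tailed_weight u R"
  proof
    show "0 < u j" for j by (rule u_pos)
    show "u s \<le> R * u (Suc s)" for s
      using R[of s] u_pos[of s] u_pos[of "Suc s"] by (simp add: divide_le_eq)
    show "\<exists>K. \<forall>\<^sub>F s in sequentially. (\<Sum>j=K..s-K. u j * u (s - j)) \<le> e * u s" if e: "0 < e" for e
    proof -
      \<comment> \<open>The convolution of \<open>u\<close> at \<open>s\<close> is a window of the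
        one of \<open>c\<close> at \<open>n = s + 2 * m\<close>, while \<open>u s\<close> is
        \<open>c (n - m)\<close>. As \<open>c (n - m) / c n\<close> tends to
        \<open>\<rho> ^ m\<close>, the factor \<open>\<rho> ^ m / 2\<close> pays for this
        mismatch.\<close>
      obtain K0 where K0: "\<And>K. K \<ge> K0 \<Longrightarrow> \<forall>\<^sub>F n in sequentially.
          (\<Sum>k=K..n-K. c k * c (n - k)) \<le> (e * \<rho> ^ m / 2) * c n"
        using subexponential_middle_small[OF F, of "e * \<rho> ^ m / 2"] e \<rho> by (auto simp: c_F)
      obtain K1 where K1: "\<And>s. s \<ge> K1 \<Longrightarrow> u s = c (s + m)"
        using u_eq by (auto simp: eventually_sequentially c_def)
      \<comment> \<open>With \<open>K1 \<le> K\<close>, both \<open>u j\<close> and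
        \<open>u (s - j)\<close> are genuine coefficients throughout the window.\<close>
      define K where "K = max K0 K1"
      have "\<forall>\<^sub>F n in sequentially. \<rho> ^ m / 2 < c (n - m) / c n"
        using shifted_ratio_tendsto[OF pos lim, of m] by (rule order_tendstoD) (use \<rho> in simp)
      then have shift_back: "\<forall>\<^sub>F n in sequentially. \<rho> ^ m / 2 * c n \<le> c (n - m)"
        using pos by eventually_elim (simp add: less_divide_eq)
      have "\<forall>\<^sub>F n in sequentially. (\<Sum>k=K+m..n-(K+m). c k * c (n - k)) \<le> (e * \<rho> ^ m / 2) * c n"
        by (rule K0) (simp add: K_def)
      with shift_back have "\<forall>\<^sub>F n in sequentially. (\<Sum>k=K+m..n-(K+m). c k * c (n - k)) \<le> e * c (n - m)"
      proof eventually_elim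
        case (elim n)
        have "(e * \<rho> ^ m / 2) * c n = e * (\<rho> ^ m / 2 * c n)" by simp
        also have "\<dots> \<le> e * c (n - m)" using elim(1) e by (intro mult_left_mono) auto
        finally show ?case using elim(2) by simp
      qed
      then have "\<forall>\<^sub>F s in sequentially.
          (\<Sum>k=K+m..s+2*m-(K+m). c k * c (s+2*m - k)) \<le> e * c (s+2*m - m)"
        by (rule eventually_compose_filterlim) (rule ev_shift)
      then have "\<forall>\<^sub>F s in sequentially. (\<Sum>j=K..s-K. u j * u (s - j)) \<le> e * u s"
        using eventually_ge_at_top[of "2 * K"]
      proof eventually_elim
        case (elim s)
        have "(\<Sum>j=K..s-K. u j * u (s - j)) = (\<Sum>j=K..s-K. c (j + m) * c (s+2*m - (j+m)))"
        proof (intro sum.cong refl)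
          fix j assume j: "j \<in> {K..s-K}"
          then have "u j = c (j + m)" "u (s - j) = c (s - j + m)"
            using elim(2) by (auto simp: K_def intro!: K1)
          moreover have "s - j + m = s + 2 * m - (j + m)" using j by auto
          ultimately show "u j * u (s - j) = c (j + m) * c (s+2*m - (j+m))" by simp
        qed
        also have "\<dots> = (\<Sum>k=K+m..s-K+m. c k * c (s+2*m - k))"
          by (simp only: sum.shift_bounds_cl_nat_ivl)
        also have "s - K + m = s+2*m-(K+m)" using elim(2) by simp
        also have "(\<Sum>k=K+m..s+2*m-(K+m). c k * c (s+2*m - k)) \<le> e * c (s+2*m - m)" by (rule elim(1))
        also have "s + 2*m - m = s + m" by simp
        also have "c (s + m) = u s" using elim(2) by (intro K1[symmetric]) (simp add: K_def)
        finally show ?case .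
      qed
      then show ?thesis by blast
    qed
  qed
  then show "\<exists>R. heavy_tailed_weight u R" by blast
qed

section \<open>Splitting off the components of minimal size\<close>

lemma total_size_filter_excess:
  assumes "\<And>x. x \<in># G \<Longrightarrow> m \<le> sz x"
  shows "total_size (\<lambda>x. sz x - m) (filter_mset (\<lambda>x. m < sz x) G) + m * size G = total_size sz G"
  using assms
proof (induction G)
  case (add x G)
  then have "m \<le> sz x" by simp
  then consider "m < sz x" | "sz x = m" by linarith
  then show ?case using add by cases (auto simp: algebra_simps)
qed simp

text \<open>Components of the minimal size \<open>m\<close> are split off; padding them with \<open>x\<^sub>0\<close> to exactly
  \<open>N\<close> components makes their number independent of the rest.\<close>

lemma card_class_multisets_bounded_le:
  fixes sz :: "'a \<Rightarrow> nat"
  assumes C: "combinatorial_class C sz" and m: "\<And>x. x \<in> C \<Longrightarrow> m \<le> sz x"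
    and x\<^sub>0: "x\<^sub>0 \<in> C" "sz x\<^sub>0 = m"
    and C': "combinatorial_class {x \<in> C. m < sz x} (\<lambda>x. sz x - m)"
  shows "card {G \<in> class_multisets C sz (s + m * N) N. \<forall>x\<in>#G. sz x - m \<le> D}
    \<le> card (sized_multisets {x \<in> {x \<in> C. m < sz x}. sz x - m \<le> D} (\<lambda>x. sz x - m) s)
        * card (multisets_of_size {x \<in> C. sz x = m} N)"
proof -
  define X where "X = {x \<in> {x \<in> C. m < sz x}. sz x - m \<le> D}"
  define Y where "Y = {x \<in> C. sz x = m}"
  define big where "big G = filter_mset (\<lambda>x. m < sz x) G" for G
  define pad where "pad G = filter_mset (\<lambda>x. \<not> m < sz x) G + replicate_mset (size (big G)) x\<^sub>0" for G
  have "card {G \<in> class_multisets C sz (s + m * N) N. \<forall>x\<in>#G. sz x - m \<le> D}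
      \<le> card (sized_multisets X (\<lambda>x. sz x - m) s \<times> multisets_of_size Y N)"
  proof (rule card_inj_on_le)
    show "inj_on (\<lambda>G. (big G, pad G))
        {G \<in> class_multisets C sz (s + m * N) N. \<forall>x\<in>#G. sz x - m \<le> D}"
      \<comment> \<open>The size of the first coordinate tells how many padding copies to remove,
        even if \<open>x\<^sub>0\<close> already occurs in the multiset.\<close>
      by (rule inj_on_inverseI[where g = "\<lambda>(G, H). G + (H - replicate_mset (size G) x\<^sub>0)"])
        (simp add: big_def pad_def)
    show "(\<lambda>G. (big G, pad G)) ` {G \<in> class_multisets C sz (s + m * N) N. \<forall>x\<in>#G. sz x - m \<le> D}
        \<subseteq> sized_multisets X (\<lambda>x. sz x - m) s \<times> multisets_of_size Y N"
    proof (rule image_subsetI)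
      fix G assume "G \<in> {G \<in> class_multisets C sz (s + m * N) N. \<forall>x\<in>#G. sz x - m \<le> D}"
      then have G: "set_mset G \<subseteq> C" "total_size sz G = s + m * N" "size G = N" "\<forall>x\<in>#G. sz x - m \<le> D"
        by (auto simp: class_multisets_def)
      have "total_size (\<lambda>x. sz x - m) (big G) = s"
        using total_size_filter_excess[of G m sz] G m by (auto simp: big_def)
      then have "big G \<in> sized_multisets X (\<lambda>x. sz x - m) s"
        using G by (auto simp: sized_multisets_def X_def big_def)
      moreover have "size (pad G) = size (filter_mset (\<lambda>x. m < sz x) G + filter_mset (\<lambda>x. \<not> m < sz x) G)"
        by (simp only: pad_def big_def size_union size_replicate_mset add.commute)
      then have "size (pad G) = N" using G(3) by (simp only: multiset_partition[symmetric])
      moreover have "set_mset (pad G) \<subseteq> Y"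
        using G(1) m x\<^sub>0 by (auto simp: pad_def Y_def not_less intro!: antisym split: if_splits)
      ultimately show "(big G, pad G) \<in> sized_multisets X (\<lambda>x. sz x - m) s \<times> multisets_of_size Y N"
        by (simp add: multisets_of_size_def)
    qed
    have "finite (sized_multisets X (\<lambda>x. sz x - m) s)"
      using finite_sized_multisets[OF C'] sized_multisets_mono by (rule rev_finite_subset) (auto simp: X_def)
    moreover have "finite Y" using C by (simp add: Y_def combinatorial_class_def)
    ultimately show "finite (sized_multisets X (\<lambda>x. sz x - m) s \<times> multisets_of_size Y N)" by blast
  qed
  then show ?thesis by (simp add: card_cartesian_product X_def Y_def)
qed

lemma finite_class_multisets: "combinatorial_class C sz \<Longrightarrow> finite (class_multisets C sz n N)"
  by (rule finite_subset[OF _ finite_sized_multisets[of C sz n]])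
    (auto simp: class_multisets_def sized_multisets_def)

lemma total_size_const:
  assumes "\<And>x. x \<in># G \<Longrightarrow> sz x = m"
  shows "total_size sz G = m * size G"
  using assms by (induction G) auto

text \<open>One component of excess \<open>s\<close> is added to \<open>N\<close> minimal ones.
  Since \<open>0 < s\<close>, it is the only component whose size is not \<open>m\<close>, so it can
  be recovered.\<close>

lemma card_class_multisets_ge:
  assumes C: "combinatorial_class C sz" and s: "0 < s"
  shows "card {x \<in> C. sz x = s + m} * card (multisets_of_size {x \<in> C. sz x = m} N)
    \<le> card (class_multisets C sz (s + m * Suc N) (Suc N))"
proof -
  define Y where "Y = {x \<in> C. sz x = m}"
  have "card ({x \<in> C. sz x = s + m} \<times> multisets_of_size Y N) \<le> card (class_multisets C sz (s + m * Suc N) (Suc N))"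
  proof (rule card_inj_on_le)
    show "inj_on (\<lambda>(x, H). add_mset x H) ({x \<in> C. sz x = s + m} \<times> multisets_of_size Y N)"
      using s by (auto simp: inj_on_def add_eq_conv_ex multisets_of_size_def Y_def)
    have "total_size sz H = m * N" if "H \<in> multisets_of_size Y N" for H
      using that by (subst total_size_const[of _ _ m]) (auto simp: multisets_of_size_def Y_def)
    then show "(\<lambda>(x, H). add_mset x H) ` ({x \<in> C. sz x = s + m} \<times> multisets_of_size Y N)
        \<subseteq> class_multisets C sz (s + m * Suc N) (Suc N)"
      by (auto simp: class_multisets_def multisets_of_size_def Y_def)
  qed (rule finite_class_multisets[OF C])
  then show ?thesis by (simp add: card_cartesian_product Y_def)
qed

text \<open>Every nonempty multiset arises by adding one element. This compares the factors with
  \<open>N\<close> and \<open>N - 1\<close> minimal components in the upper and lower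
  bounds.\<close>

lemma card_multisets_of_size_Suc_le:
  assumes "finite Y"
  shows "card (multisets_of_size Y (Suc N)) \<le> card Y * card (multisets_of_size Y N)"
proof -
  have "multisets_of_size Y (Suc N) \<subseteq> (\<lambda>(x, H). add_mset x H) ` (Y \<times> multisets_of_size Y N)"
  proof
    fix G assume G: "G \<in> multisets_of_size Y (Suc N)"
    then obtain x H where "G = add_mset x H"
      by (auto simp: multisets_of_size_def dest!: size_eq_Suc_imp_eq_union)
    with G show "G \<in> (\<lambda>(x, H). add_mset x H) ` (Y \<times> multisets_of_size Y N)"
      by (auto simp: multisets_of_size_def)
  qed
  then have "card (multisets_of_size Y (Suc N)) \<le> card (Y \<times> multisets_of_size Y N)"
    using assms by (intro surj_card_le) auto
  then show ?thesis by (simp add: card_cartesian_product)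
qed

section \<open>Tail bound for the largest component and passage to the limit\<close>

lemma min_size_properties:
  assumes C: "combinatorial_class C sz" and F: "subexponential (generating_series C sz) \<rho>"
  shows "\<exists>x\<in>C. sz x = min_size C sz" and "x \<in> C \<Longrightarrow> min_size C sz \<le> sz x"
proof -
  have ev: "\<forall>\<^sub>F n in sequentially. 0 < card {x \<in> C. sz x = n}"
    using F by (simp add: subexponential_def generating_series_def)
  obtain k where "1 \<le> k" "0 < card {x \<in> C. sz x = k}"
    using eventually_happens[OF eventually_conj[OF ev eventually_ge_at_top[of 1]]] by auto
  then have "0 < card {x \<in> C. sz x = min_size C sz}"
    unfolding min_size_def by (rule_tac LeastI2[of _ k]) auto
  then show "\<exists>x\<in>C. sz x = min_size C sz" by (auto simp: card_gt_0_iff)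
  assume x: "x \<in> C"
  then have "0 < card {y \<in> C. sz y = sz x}" "1 \<le> sz x"
    using C by (auto simp: combinatorial_class_def card_gt_0_iff)
  then show "min_size C sz \<le> sz x"
    unfolding min_size_def by (intro Least_le) auto
qed

text \<open>The excesses add up to \<open>s\<close>, so the largest component has size at most
  \<open>s + m\<close>. A deviation of \<open>K + m + 1\<close> must then be downward, and it bounds
  all components at once.\<close>

lemma deviating_largest_component:
  assumes G: "G \<in> class_multisets C sz (s + m * N) N"
    and m: "\<And>x. x \<in> C \<Longrightarrow> m \<le> sz x"
    and dev: "real (K + m + 1) \<le> \<bar>real (largest_component sz G) - real s\<bar>"
  shows "\<forall>x\<in>#G. sz x - m \<le> s - K"
proof
  fix x assume x: "x \<in># G"
  have G': "set_mset G \<subseteq> C" "total_size sz G = s + m * N" "size G = N"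
    using G by (auto simp: class_multisets_def)
  have le: "sz y \<le> s + m" if "y \<in># G" for y
  proof (cases "m < sz y")
    case True
    have "y \<in># filter_mset (\<lambda>x. m < sz x) G" using that True by simp
    then have "sz y - m \<le> total_size (\<lambda>x. sz x - m) (filter_mset (\<lambda>x. m < sz x) G)"
      by (rule sz_le_total_size[where sz = "\<lambda>x. sz x - m"])
    also have "\<dots> = s" using total_size_filter_excess[of G m sz] G' m by auto
    finally show ?thesis by simp
  qed simp
  have "largest_component sz G \<in> sz ` set_mset G"
    unfolding largest_component_def using x by (intro Max_in) auto
  then have "largest_component sz G \<le> s + m" using le by auto
  moreover have "sz x \<le> largest_component sz G"
    unfolding largest_component_def using x by (intro Max_ge) auto
  ultimately show "sz x - m \<le> s - K" using dev by linarith
qed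

text \<open>The bound is uniform in \<open>N\<close> because the upper bound for the bad multisets
  and the lower bound for all of them share the factor \<open>h (N - 1)\<close>, which
  cancels.\<close>

lemma largest_component_tail:
  assumes C: "combinatorial_class C sz" and F: "subexponential (generating_series C sz) \<rho>"
    and m: "m = min_size C sz" and e: "0 < e"
  shows "\<exists>K. \<forall>\<^sub>F s in sequentially. \<forall>N\<ge>1.
    measure_pmf.prob (pmf_of_set (class_multisets C sz (s + m * N) N))
      {G. real K \<le> \<bar>real (largest_component sz G) - real s\<bar>} \<le> e"
proof -
  obtain x\<^sub>0 where x\<^sub>0: "x\<^sub>0 \<in> C" "sz x\<^sub>0 = m"
    using min_size_properties(1)[OF C F] m by auto
  have m_le: "m \<le> sz x" if "x \<in> C" for x
    using min_size_properties(2)[OF C F that] m by simp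
  define a where "a n = card {x \<in> C. sz x = n}" for n
  define u where "u j = max 1 (real (a (j + m)))" for j
  define C' where "C' = {x \<in> C. m < sz x}"
  have a: "fps_nth (generating_series C sz) n = real (a n)" for n
    by (simp add: generating_series_def a_def)
  note weight = subexponential_integral_weight[OF F a u_def]
  obtain R where "heavy_tailed_weight u R" using weight(1) by blast
  then interpret u: heavy_tailed_weight u R .
  obtain B where B: "0 < B" "\<And>s. (\<Sum>d\<le>s. u d) \<le> B * u s" using weight(2) by blast
  have sizes: "{x \<in> C'. sz x - m = d} = {x \<in> C. sz x = d + m}" if "1 \<le> d" for d
    using that by (auto simp: C'_def)
  have C': "combinatorial_class C' (\<lambda>x. sz x - m)"
    unfolding combinatorial_class_def
  proof (intro conjI allI ballI)
    show "countable C'" using C by (auto simp: combinatorial_class_def C'_def)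
    show "1 \<le> sz x - m" if "x \<in> C'" for x using that by (auto simp: C'_def)
    show "finite {x \<in> C'. sz x - m = d}" for d
      by (rule finite_subset[of _ "{x \<in> C. sz x = d + m}"])
        (use C in \<open>auto simp: combinatorial_class_def C'_def\<close>)
  qed
  have sums: "(\<Sum>d=1..j. real (card {x \<in> C'. sz x - m = d})) \<le> B * u j" for j
  proof -
    have "(\<Sum>d=1..j. real (card {x \<in> C'. sz x - m = d})) \<le> (\<Sum>d=1..j. u d)"
      by (intro sum_mono) (simp add: sizes u_def a_def)
    also have "\<dots> \<le> (\<Sum>d\<le>j. u d)" using u.pos by (intro sum_mono2) (auto simp: less_imp_le)
    also have "\<dots> \<le> B * u j" by (rule B)
    finally show ?thesis .
  qed
  have am: "0 < a m" using x\<^sub>0 C by (auto simp: a_def card_gt_0_iff combinatorial_class_def)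
  \<comment> \<open>Dividing by \<open>a m\<close> compensates the loss in
    \<open>h N \<le> a m * h (N - 1)\<close>.\<close>
  obtain K where K: "\<forall>\<^sub>F s in sequentially.
      real (card (sized_multisets {x \<in> C'. sz x - m \<le> s - K} (\<lambda>x. sz x - m) s)) \<le> e / real (a m) * u s"
    using u.card_bounded_components_small[OF C' B(1) sums weight(3), of "e / real (a m)"] e am by auto
  have "\<forall>\<^sub>F s in sequentially. \<forall>N\<ge>1.
      measure_pmf.prob (pmf_of_set (class_multisets C sz (s + m * N) N))
        {G. real (K + m + 1) \<le> \<bar>real (largest_component sz G) - real s\<bar>} \<le> e"
    using K weight(4) eventually_gt_at_top[of 0]
  proof eventually_elim
    case (elim s)
    show ?case
    proof (intro allI impI)
      fix N :: nat assume N: "1 \<le> N"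
      define \<G> where "\<G> = class_multisets C sz (s + m * N) N"
      define Bad where "Bad = {G. real (K + m + 1) \<le> \<bar>real (largest_component sz G) - real s\<bar>}"
      define h where "h j = card (multisets_of_size {x \<in> C. sz x = m} j)" for j
      define T where "T = card (sized_multisets {x \<in> C'. sz x - m \<le> s - K} (\<lambda>x. sz x - m) s)"
      have fin: "finite \<G>" unfolding \<G>_def by (rule finite_class_multisets[OF C])
      have fin_m: "finite {x \<in> C. sz x = m}" using C by (simp add: combinatorial_class_def)
      have "replicate_mset (N - 1) x\<^sub>0 \<in> multisets_of_size {x \<in> C. sz x = m} (N - 1)"
        using x\<^sub>0 by (auto simp: multisets_of_size_def split: if_splits)
      then have h_pos: "0 < h (N - 1)"
        unfolding h_def using finite_multisets_of_size[OF fin_m] by (auto simp: card_gt_0_iff)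
      have h_le: "h N \<le> a m * h (N - 1)"
        using card_multisets_of_size_Suc_le[OF fin_m, of "N - 1"] N by (simp add: h_def a_def)
      have "a (s + m) * h (N - 1) \<le> card \<G>"
        using card_class_multisets_ge[OF C elim(3), of m "N - 1"] N by (simp add: h_def a_def \<G>_def)
      then have "real (a (s + m) * h (N - 1)) \<le> real (card \<G>)" by (simp only: of_nat_le_iff)
      then have lower: "u s * real (h (N - 1)) \<le> real (card \<G>)" using elim(2) by simp
      then have card_pos: "0 < card \<G>"
        using u.pos[of s] h_pos by (smt (verit) mult_pos_pos of_nat_0_less_iff)
      have "\<G> \<inter> Bad \<subseteq> {G \<in> \<G>. \<forall>x\<in>#G. sz x - m \<le> s - K}"
        unfolding \<G>_def Bad_def
        by (intro subsetI CollectI conjI deviating_largest_component[where K = K, OF _ m_le]) auto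
      then have "card (\<G> \<inter> Bad) \<le> card {G \<in> \<G>. \<forall>x\<in>#G. sz x - m \<le> s - K}"
        using fin by (intro card_mono) auto
      also have "\<dots> \<le> T * h N"
        using card_class_multisets_bounded_le[OF C m_le x\<^sub>0 C'[unfolded C'_def]]
        by (simp add: \<G>_def T_def h_def C'_def)
      also have "\<dots> \<le> T * (a m * h (N - 1))" using h_le by (rule mult_le_mono2)
      finally have "real (card (\<G> \<inter> Bad)) \<le> real (T * (a m * h (N - 1)))" by (simp only: of_nat_le_iff)
      also have "\<dots> = real T * (real (a m) * real (h (N - 1)))" by simp
      also have "\<dots> \<le> e / real (a m) * u s * (real (a m) * real (h (N - 1)))"
        using elim(1) by (intro mult_right_mono) (auto simp: T_def)
      also have "\<dots> = e * (u s * real (h (N - 1)))" using am by simp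
      also have "\<dots> \<le> e * real (card \<G>)" using lower e by (intro mult_left_mono) auto
      finally have "real (card (\<G> \<inter> Bad)) / real (card \<G>) \<le> e"
        using card_pos by (simp add: divide_le_eq)
      \<comment> \<open>Nonemptiness, together with finiteness, makes \<open>pmf_of_set\<close> the
        uniform distribution.\<close>
      moreover have "\<G> \<noteq> {}" using card_pos by auto
      ultimately have "measure_pmf.prob (pmf_of_set \<G>) Bad \<le> e"
        using fin by (simp add: measure_pmf_of_set)
      then show "measure_pmf.prob (pmf_of_set (class_multisets C sz (s + m * N) N))
          {G. real (K + m + 1) \<le> \<bar>real (largest_component sz G) - real s\<bar>} \<le> e"
        unfolding \<G>_def Bad_def .
    qed
  qed
  then show ?thesis by blast
qed

theorem theorem1p2:
  fixes C :: "'a set" and sz :: "'a \<Rightarrow> nat" and \<rho> :: real and m :: nat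
    and n N :: "nat \<Rightarrow> nat"
  assumes "combinatorial_class C sz"
    and "subexponential (generating_series C sz) \<rho>"
    and "m = min_size C sz"
    and "\<And>i. 1 \<le> n i" and "\<And>i. 1 \<le> N i"
    and "filterlim n at_top sequentially"
    and "filterlim N at_top sequentially"
    and "filterlim (\<lambda>i. int (n i) - int m * int (N i)) at_top sequentially"
  shows "stochastically_bounded
           (\<lambda>i. pmf_of_set (class_multisets C sz (n i) (N i)))
           (\<lambda>i G. real (largest_component sz G) - (real (n i) - real m * real (N i)))"
  unfolding stochastically_bounded_def
proof (intro allI impI)
  fix e :: real assume e: "0 < e"
  define s where "s i = nat (int (n i) - int m * int (N i))" for i
  obtain K where K: "\<forall>\<^sub>F s in sequentially. \<forall>N\<ge>1.
      measure_pmf.prob (pmf_of_set (class_multisets C sz (s + m * N) N))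
        {G. real K \<le> \<bar>real (largest_component sz G) - real s\<bar>} \<le> e"
    using largest_component_tail[OF assms(1-3) e] by blast
  have "filterlim s at_top sequentially"
    unfolding s_def by (rule filterlim_compose[OF filterlim_nat_sequentially assms(8)])
  then have "\<forall>\<^sub>F i in sequentially. \<forall>N\<ge>1.
      measure_pmf.prob (pmf_of_set (class_multisets C sz (s i + m * N) N))
        {G. real K \<le> \<bar>real (largest_component sz G) - real (s i)\<bar>} \<le> e"
    by (rule eventually_compose_filterlim[OF K])
  \<comment> \<open>Once the difference is nonnegative, \<open>nat\<close> loses nothing and
    \<open>n i = s i + m * N i\<close> holds exactly.\<close>
  moreover have "\<forall>\<^sub>F i in sequentially. 0 \<le> int (n i) - int m * int (N i)"
    using assms(8) unfolding filterlim_at_top by blast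
  \<comment> \<open>\<open>K + 1\<close> replaces \<open>K\<close> because the witness for
    stochastic boundedness must be positive.\<close>
  ultimately have "\<forall>\<^sub>F i in sequentially.
      measure_pmf.prob (pmf_of_set (class_multisets C sz (n i) (N i)))
        {G. real (K + 1) \<le> \<bar>real (largest_component sz G) - (real (n i) - real m * real (N i))\<bar>} \<le> e"
  proof eventually_elim
    case (elim i)
    have "int (n i) = int (s i + m * N i)" using elim(2) by (simp add: s_def)
    then have n: "n i = s i + m * N i" by (simp only: of_nat_eq_iff)
    have "measure_pmf.prob (pmf_of_set (class_multisets C sz (n i) (N i)))
        {G. real (K + 1) \<le> \<bar>real (largest_component sz G) - (real (n i) - real m * real (N i))\<bar>}
      \<le> measure_pmf.prob (pmf_of_set (class_multisets C sz (s i + m * N i) (N i)))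
        {G. real K \<le> \<bar>real (largest_component sz G) - real (s i)\<bar>}"
      unfolding n by (intro measure_pmf.finite_measure_mono) auto
    also have "\<dots> \<le> e" using elim(1) assms(5) by blast
    finally show ?case .
  qed
  then have "limsup (\<lambda>i. ereal (measure_pmf.prob (pmf_of_set (class_multisets C sz (n i) (N i)))
      {G. real (K + 1) \<le> \<bar>real (largest_component sz G) - (real (n i) - real m * real (N i))\<bar>})) \<le> ereal e"
    by (intro Limsup_bounded) (auto elim: eventually_mono)
  then show "\<exists>K>0. limsup (\<lambda>i. ereal (measure_pmf.prob (pmf_of_set (class_multisets C sz (n i) (N i)))
      {G. K \<le> \<bar>real (largest_component sz G) - (real (n i) - real m * real (N i))\<bar>})) \<le> ereal e"
    by (intro exI[of _ "real (K + 1)"]) simp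
qed

end
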